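(* Let $\alpha\in(0,2)$ and $H>0$. Let $X_\alpha$ be a symmetric $\alpha$-stable self-similar mixed moving average with self-similarity parameter $H$ and kernel $G:X\times\mathbb{R}\to\mathbb{R}$, generated by a nonsingular measurable flow $\{\psi_c\}_{c>0}$ on a standard Lebesgue space $(X,\mathcal{X},\mu)$, so that, for all $c>0$, $$c^{-(H-1/\alpha)}G(x,cu)=b_c(x)\left\{\frac{d(\mu\circ\psi_c)}{d\mu}(x)\right\}^{1/\alpha}G\big(\psi_c(x),u+g_c(x)\big)+j_c(x)\quad\text{a.e. }\mu(dx)\,du,\qquad( * )$$ where $\{b_c\}_{c>0}$ is a cocycle for the flow with values in $\{-1,1\}$, $\{g_c\}_{c>0}$ is a $1$-semi-additive functional for the flow, and $j_c(x):(0,\infty)\times X\to\mathbb{R}$ is some function. Then the function $j_c(x)$ in $( * )$ can be taken to be a $2$-semi-additive functional for the flow $\{\psi_c\}_{c>0}$ and the cocycle $\{b_c\}_{c>0}$; that is, there is a $2$-semi-additive functional $\{\widetilde j_c\}_{c>0}$ for $\{\psi_c\}_{c>0}$ and $\{b_c\}_{c>0}$ such that, for every $c>0$, $\widetilde j_c(x)=j_c(x)$ for $\mu$-a.e. $x$, so that $( * )$ holds with $j_c$ replaced by $\widetilde j_c$.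
   Context: A standard Lebesgue space is a standard Borel space with a $\sigma$-finite measure. A (multiplicative) flow $\{\psi_c\}_{c>0}$ on $X$ is a family of maps $\psi_c:X\to X$ with $\psi_{c_1c_2}(x)=\psi_{c_1}(\psi_{c_2}(x))$ for all $c_1,c_2>0$, $x\in X$, and $\psi_1(x)=x$. It is measurable if $(c,x)\mapsto\psi_c(x)$ is measurable on $(0,\infty)\times X$, and nonsingular if $\mu(A)=0$ implies $\mu(\psi_c^{-1}(A))=0$ for all $c>0$, $A\in\mathcal{X}$. Here $(\mu\circ\psi_c)(A)=\mu(\psi_c(A))$. A cocycle for the flow with values in $Y$ ($Y=\{-1,1\}$, $(0,\infty)$ or $\mathbb{R}\setminus\{0\}$) is a measurable map $(c,x)\mapsto b_c(x)$ from $(0,\infty)\times X$ to $Y$ with $b_{c_1c_2}(x)=b_{c_1}(x)b_{c_2}(\psi_{c_1}(x))$ for all $c_1,c_2>0$, $x\in X$. A $1$-semi-additive functional for the flow is a measurable function $g_c(x):(0,\infty)\times X\to\mathbb{R}$ with $g_{c_1c_2}(x)=\frac{g_{c_1}(x)}{c_2}+g_{c_2}(\psi_{c_1}(x))$ for all $c_1,c_2>0$, $x\in X$. A $2$-semi-additive functional for the flow $\{\psi_c\}$ and the cocycle $\{b_c\}$ is a measurable function $j_c(x):(0,\infty)\times X\to\mathbb{R}$ with $$j_{c_1c_2}(x)=c_2^{-(H-1/\alpha)}j_{c_1}(x)+b_{c_1}(x)\left\{\frac{d(\mu\circ\psi_{c_1})}{d\mu}(x)\right\}^{1/\alpha}j_{c_2}(\psi_{c_1}(x))\quad\text{for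 all }c_1,c_2>0,\ x\in X,$$ where $\{d(\mu\circ\psi_c)/d\mu\}_{c>0}$ denotes a version of the Radon-Nikodym derivatives which (1) is jointly measurable in $(c,x)$, (2) is a cocycle $(0,\infty)\times X\to(0,\infty)$ for the flow, and (3) is, for each $c>0$, a Radon-Nikodym derivative of $\mu\circ\psi_c$ with respect to $\mu$. A symmetric $\alpha$-stable mixed moving average is a process $X_\alpha=\{X_\alpha(t)\}_{t\in\mathbb{R}}$ whose finite-dimensional distributions are given by $$E\exp\Big\{i\sum_{k=1}^n\theta_kX_\alpha(t_k)\Big\}=\exp\Big\{-\int_X\int_{\mathbb{R}}\Big|\sum_{k=1}^n\theta_kG_{t_k}(x,u)\Big|^\alpha\mu(dx)\,du\Big\},$$ where $G:X\times\mathbb{R}\to\mathbb{R}$ is measurable, $G_t(x,u)=G(x,t+u)-G(x,u)$, and $\{G_t\}_{t\in\mathbb{R}}\subset L^\alpha(X\times\mathbb{R},\mu(dx)du)$. It is self-similar with parameter $H>0$ if for every $c>0$ the processes $\{X_\alpha(ct)\}_{t\in\mathbb{R}}$ and $\{c^HX_\alpha(t)\}_{t\in\mathbb{R}}$ have the same finite-dimensional distributions. A self-similar mixed moving average is said to be generated by the nonsingular measurable flow $\{\psi_c\}_{c>0}$ if relation $( * )$ of the claim holds for all $c>0$ with $b,g,j$ as described there, and if in addition $\mathrm{supp}\{G_t,t\in\mathbb{R}\}=X\times\mathbb{R}$ a.e. $\mu(dx)du$. Here $\mathrm{supp}\{G_t,t\in\mathbb{R}\}$ is a minimal (a.e.)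 set $A\subset X\times\mathbb{R}$ such that $m\{(x,u)\notin A:G_t(x,u)\neq0\}=0$ for every $t\in\mathbb{R}$, with $dm=\mu(dx)du$. *)

theory Defs
  imports "HOL-Probability.Probability"
begin

section \<open>Standard Lebesgue spaces\<close>

definition standard_borel_space :: "'a measure \<Rightarrow> bool" where
  "standard_borel_space M \<longleftrightarrow>
     (\<exists>T. completely_metrizable_space T \<and> second_countable T \<and>
          topspace T = space M \<and> sets M = sigma_sets (topspace T) {U. openin T U})"

definition standard_lebesgue_space :: "'a measure \<Rightarrow> bool" where
  "standard_lebesgue_space M \<longleftrightarrow> standard_borel_space M \<and> sigma_finite_measure M"

section \<open>Multiplicative flows, cocycles and semi-additive functionals\<close>

text \<open>Families indexed by \<open>c > 0\<close> are total functions of a real index; nothing is required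
  of their values for \<open>c \<le> 0\<close> or outside \<open>space M\<close>.\<close>

abbreviation pos_borel :: "real measure" where
  "pos_borel \<equiv> restrict_space borel {0<..}"

definition measurable_flow :: "'a measure \<Rightarrow> (real \<Rightarrow> 'a \<Rightarrow> 'a) \<Rightarrow> bool" where
  "measurable_flow M \<psi> \<longleftrightarrow>
     (\<lambda>(c, x). \<psi> c x) \<in> pos_borel \<Otimes>\<^sub>M M \<rightarrow>\<^sub>M M \<and>
     (\<forall>c1>0. \<forall>c2>0. \<forall>x\<in>space M. \<psi> (c1 * c2) x = \<psi> c1 (\<psi> c2 x)) \<and>
     (\<forall>x\<in>space M. \<psi> 1 x = x)"

definition nonsingular_flow :: "'a measure \<Rightarrow> (real \<Rightarrow> 'a \<Rightarrow> 'a) \<Rightarrow> bool" where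
  "nonsingular_flow M \<psi> \<longleftrightarrow>
     (\<forall>c>0. \<forall>A\<in>sets M. emeasure M A = 0 \<longrightarrow> emeasure M (\<psi> c -` A \<inter> space M) = 0)"

definition flow_cocycle ::
    "'a measure \<Rightarrow> (real \<Rightarrow> 'a \<Rightarrow> 'a) \<Rightarrow> real set \<Rightarrow> (real \<Rightarrow> 'a \<Rightarrow> real) \<Rightarrow> bool" where
  "flow_cocycle M \<psi> Y b \<longleftrightarrow>
     (\<lambda>(c, x). b c x) \<in> pos_borel \<Otimes>\<^sub>M M \<rightarrow>\<^sub>M restrict_space borel Y \<and>
     (\<forall>c1>0. \<forall>c2>0. \<forall>x\<in>space M. b (c1 * c2) x = b c1 x * b c2 (\<psi> c1 x))"

text \<open>A version of the derivatives \<open>d(\<mu> \<circ> \<psi>\<^sub>c)/d\<mu>\<close>, where \<open>(\<mu> \<circ> \<psi>\<^sub>c)(A) = \<mu>(\<psi>\<^sub>c(A))\<close>. For a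
  measurable flow the image of \<open>A\<close> under \<open>\<psi> c\<close> is measurable, being the preimage under
  \<open>\<psi> (1 / c)\<close>. Joint measurability and positivity are part of \<^const>\<open>flow_cocycle\<close>.\<close>

definition flow_RN_version ::
    "'a measure \<Rightarrow> (real \<Rightarrow> 'a \<Rightarrow> 'a) \<Rightarrow> (real \<Rightarrow> 'a \<Rightarrow> real) \<Rightarrow> bool" where
  "flow_RN_version M \<psi> D \<longleftrightarrow>
     flow_cocycle M \<psi> {0<..} D \<and>
     (\<forall>c>0. \<forall>A\<in>sets M. emeasure M (\<psi> c ` A) = (\<integral>\<^sup>+x\<in>A. ennreal (D c x) \<partial>M))"

definition one_semi_additive ::
    "'a measure \<Rightarrow> (real \<Rightarrow> 'a \<Rightarrow> 'a) \<Rightarrow> (real \<Rightarrow> 'a \<Rightarrow> real) \<Rightarrow> bool" where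
  "one_semi_additive M \<psi> g \<longleftrightarrow>
     (\<lambda>(c, x). g c x) \<in> borel_measurable (pos_borel \<Otimes>\<^sub>M M) \<and>
     (\<forall>c1>0. \<forall>c2>0. \<forall>x\<in>space M. g (c1 * c2) x = g c1 x / c2 + g c2 (\<psi> c1 x))"

definition two_semi_additive ::
    "real \<Rightarrow> real \<Rightarrow> 'a measure \<Rightarrow> (real \<Rightarrow> 'a \<Rightarrow> 'a) \<Rightarrow> (real \<Rightarrow> 'a \<Rightarrow> real)
     \<Rightarrow> (real \<Rightarrow> 'a \<Rightarrow> real) \<Rightarrow> (real \<Rightarrow> 'a \<Rightarrow> real) \<Rightarrow> bool" where
  "two_semi_additive \<alpha> H M \<psi> D b j \<longleftrightarrow>
     (\<lambda>(c, x). j c x) \<in> borel_measurable (pos_borel \<Otimes>\<^sub>M M) \<and>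
     (\<forall>c1>0. \<forall>c2>0. \<forall>x\<in>space M.
        j (c1 * c2) x =
          c2 powr (- (H - 1 / \<alpha>)) * j c1 x + b c1 x * D c1 x powr (1 / \<alpha>) * j c2 (\<psi> c1 x))"

section \<open>Symmetric stable mixed moving averages\<close>

definition increment_kernel :: "('a \<times> real \<Rightarrow> real) \<Rightarrow> real \<Rightarrow> 'a \<times> real \<Rightarrow> real" where
  "increment_kernel G t = (\<lambda>(x, u). G (x, t + u) - G (x, u))"

definition mixed_moving_average_kernel ::
    "real \<Rightarrow> 'a measure \<Rightarrow> ('a \<times> real \<Rightarrow> real) \<Rightarrow> bool" where
  "mixed_moving_average_kernel \<alpha> M G \<longleftrightarrow>
     G \<in> borel_measurable (M \<Otimes>\<^sub>M lborel) \<and>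
     (\<forall>t. integrable (M \<Otimes>\<^sub>M lborel) (\<lambda>p. \<bar>increment_kernel G t p\<bar> powr \<alpha>))"

definition SaS_mixed_moving_average ::
    "real \<Rightarrow> 'a measure \<Rightarrow> ('a \<times> real \<Rightarrow> real) \<Rightarrow> 'w measure \<Rightarrow> (real \<Rightarrow> 'w \<Rightarrow> real) \<Rightarrow> bool" where
  "SaS_mixed_moving_average \<alpha> M G P X \<longleftrightarrow>
     mixed_moving_average_kernel \<alpha> M G \<and>
     prob_space P \<and> (\<forall>t. X t \<in> borel_measurable P) \<and>
     (\<forall>n::nat. \<forall>\<theta> t :: nat \<Rightarrow> real.
        (\<integral>\<omega>. exp (\<i> * complex_of_real (\<Sum>k=1..n. \<theta> k * X (t k) \<omega>)) \<partial>P) =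
        complex_of_real (exp (- (\<integral>p. \<bar>\<Sum>k=1..n. \<theta> k * increment_kernel G (t k) p\<bar> powr \<alpha>
                                   \<partial>(M \<Otimes>\<^sub>M lborel)))))"

definition same_fdds ::
    "'w measure \<Rightarrow> (real \<Rightarrow> 'w \<Rightarrow> real) \<Rightarrow> (real \<Rightarrow> 'w \<Rightarrow> real) \<Rightarrow> bool" where
  "same_fdds P X Y \<longleftrightarrow>
     (\<forall>J. finite J \<longrightarrow>
        distr P (\<Pi>\<^sub>M t\<in>J. borel) (\<lambda>\<omega>. \<lambda>t\<in>J. X t \<omega>) =
        distr P (\<Pi>\<^sub>M t\<in>J. borel) (\<lambda>\<omega>. \<lambda>t\<in>J. Y t \<omega>))"

definition self_similar :: "real \<Rightarrow> 'w measure \<Rightarrow> (real \<Rightarrow> 'w \<Rightarrow> real) \<Rightarrow> bool" where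
  "self_similar H P X \<longleftrightarrow>
     (\<forall>c>0. same_fdds P (\<lambda>t. X (c * t)) (\<lambda>t \<omega>. c powr H * X t \<omega>))"

section \<open>Generation by a flow\<close>

definition carries_kernel :: "'a measure \<Rightarrow> ('a \<times> real \<Rightarrow> real) \<Rightarrow> ('a \<times> real) set \<Rightarrow> bool" where
  "carries_kernel M G A \<longleftrightarrow>
     A \<in> sets (M \<Otimes>\<^sub>M lborel) \<and>
     (\<forall>t. emeasure (M \<Otimes>\<^sub>M lborel)
            {p \<in> space (M \<Otimes>\<^sub>M lborel). p \<notin> A \<and> increment_kernel G t p \<noteq> 0} = 0)"

definition is_kernel_support :: "'a measure \<Rightarrow> ('a \<times> real \<Rightarrow> real) \<Rightarrow> ('a \<times> real) set \<Rightarrow> bool" where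
  "is_kernel_support M G A \<longleftrightarrow>
     carries_kernel M G A \<and>
     (\<forall>B. carries_kernel M G B \<longrightarrow> emeasure (M \<Otimes>\<^sub>M lborel) (A - B) = 0)"

definition full_support :: "'a measure \<Rightarrow> ('a \<times> real \<Rightarrow> real) \<Rightarrow> bool" where
  "full_support M G \<longleftrightarrow>
     (\<exists>A. is_kernel_support M G A \<and> (AE p in M \<Otimes>\<^sub>M lborel. p \<in> A))"

definition flow_relation ::
    "real \<Rightarrow> real \<Rightarrow> 'a measure \<Rightarrow> ('a \<times> real \<Rightarrow> real) \<Rightarrow> (real \<Rightarrow> 'a \<Rightarrow> 'a)
     \<Rightarrow> (real \<Rightarrow> 'a \<Rightarrow> real) \<Rightarrow> (real \<Rightarrow> 'a \<Rightarrow> real) \<Rightarrow> (real \<Rightarrow> 'a \<Rightarrow> real)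
     \<Rightarrow> (real \<Rightarrow> 'a \<Rightarrow> real) \<Rightarrow> bool" where
  "flow_relation \<alpha> H M G \<psi> D b g j \<longleftrightarrow>
     (\<forall>c>0. AE (x, u) in M \<Otimes>\<^sub>M lborel.
        c powr (- (H - 1 / \<alpha>)) * G (x, c * u) =
          b c x * D c x powr (1 / \<alpha>) * G (\<psi> c x, u + g c x) + j c x)"

end

(* Substituting u/c for u, the relation of the claim says that G(x, .) agrees, up to an
   additive constant and a.e. in u, with the pullback T_{c,x} G(psi_c x, .), where T is a strict cocycle of affine changes
   of variable; j is the constant, up to a power of c. If the classes modulo constants agreed for
   all (c, x), the constants would automatically form a strict cocycle. By Fubini, for x outside
   a null set they agree for a.e. c; call such x regular. The set of x whose orbit is
   a.e. regular is conull and invariant. At its non-regular points G(x, .) is replaced by a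
   median over c of the pullbacks T_{c,x} G(psi_c x, .), which all agree modulo constants. The
   constant of the repaired kernel, extended by 0 off the invariant set, is the required
   functional. *)
theory Submission
  imports Defs
begin

section \<open>Measurability of almost-everywhere conditions on sections\<close>

lemma pred_AE_lborel:
  assumes [measurable]: "Measurable.pred (N \<Otimes>\<^sub>M borel) (\<lambda>(x, u). Q x u)"
  shows "Measurable.pred N (\<lambda>x. AE u in lborel. Q x (u::real))"
proof -
  interpret lborel: sigma_finite_measure "lborel :: real measure"
    by (rule sigma_finite_lborel)
  define B where "B = {p \<in> space (N \<Otimes>\<^sub>M lborel). \<not> Q (fst p) (snd p)}"
  have "B \<in> sets (N \<Otimes>\<^sub>M borel)"
    unfolding B_def space_pair_measure space_lborel space_borel
    using assms unfolding pred_def space_pair_measure by (auto simp: split_beta)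
  then have B: "B \<in> sets (N \<Otimes>\<^sub>M lborel)" by (simp add: sets_pair_measure_cong[OF refl sets_lborel])
  have "(AE u in lborel. Q x u) \<longleftrightarrow> emeasure lborel (Pair x -` B) = 0" if x: "x \<in> space N" for x
  proof -
    have "Pair x -` B = {u \<in> space lborel. \<not> Q x u}"
      using x by (auto simp: B_def space_pair_measure)
    moreover have "Pair x -` B \<in> sets lborel"
      using B by (rule sets_Pair1)
    ultimately show ?thesis
      using AE_iff_measurable[of "Pair x -` B" lborel "Q x"] by simp
  qed
  moreover have "Measurable.pred N (\<lambda>x. emeasure lborel (Pair x -` B) = 0)"
    using lborel.measurable_emeasure_Pair[OF B] by measurable
  ultimately show ?thesis
    by (subst measurable_cong)
qed

section \<open>Medians with respect to the Gaussian law\<close>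

definition gauss :: "real measure" where
  "gauss = density lborel std_normal_density"

lemma prob_space_gauss: "prob_space gauss"
  unfolding gauss_def by (rule prob_space_normal_density) simp

lemma sets_gauss [measurable_cong, simp]: "sets gauss = sets borel"
  and space_gauss [simp]: "space gauss = UNIV"
  by (simp_all add: gauss_def)

text \<open>The normal density is positive everywhere, so \<open>gauss\<close> is a probability
  measure with the null sets of Lebesgue measure: medians exist and see only a.e. classes.\<close>

lemma AE_gauss_iff: "(AE u in gauss. Q u) \<longleftrightarrow> (AE u in lborel. Q u)"
  unfolding gauss_def by (subst AE_density) (auto simp: normal_density_pos)

text \<open>The point of the median is that it is a measurable functional, defined without any
  integrability condition, that commutes with adding constants.\<close>

definition median :: "(real \<Rightarrow> real) \<Rightarrow> real" where
  "median f = Inf {a. 1 / 2 \<le> measure gauss {u. f u \<le> a}}"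

text \<open>The distribution function of \<open>f\<close> under \<open>gauss\<close> is
  right-continuous, and \<open>median f\<close> is its generalised inverse at 1/2; the equivalence
  is the Galois property of that inverse.\<close>

lemma median_le_iff:
  assumes [measurable]: "f \<in> borel_measurable borel"
  shows "median f \<le> a \<longleftrightarrow> 1 / 2 \<le> measure gauss {u. f u \<le> a}"
proof -
  interpret gauss: prob_space gauss by (rule prob_space_gauss)
  interpret cdf_distribution "distr gauss borel f"
    by (intro cdf_distribution.intro real_distribution.intro gauss.prob_space_distr
        real_distribution_axioms.intro) (simp_all)
  have *: "cdf (distr gauss borel f) x = measure gauss {u. f u \<le> x}" for x
    by (simp add: cdf_def measure_distr vimage_def)
  show ?thesis
    using pseudoinverse[of "1/2" a] unfolding * median_def by simp
qed

lemma median_eqI: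
  assumes "f \<in> borel_measurable borel" "\<And>a. m \<le> a \<longleftrightarrow> 1 / 2 \<le> measure gauss {u. f u \<le> a}"
  shows "median f = m"
  using assms median_le_iff[OF assms(1)] by (metis order_antisym order_refl)

lemma median_cong_AE:
  assumes [measurable]: "f \<in> borel_measurable borel" "f' \<in> borel_measurable borel"
    and "AE u in lborel. f u = f' u"
  shows "median f = median f'"
proof -
  interpret gauss: prob_space gauss by (rule prob_space_gauss)
  have ae: "AE u in gauss. f u = f' u"
    using assms(3) by (simp add: AE_gauss_iff)
  have "measure gauss {u. f u \<le> a} = measure gauss {u. f' u \<le> a}" for a
    by (rule gauss.finite_measure_eq_AE) (use ae in \<open>auto elim!: eventually_mono\<close>)
  then show ?thesis by (simp add: median_def)
qed

lemma median_shift: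
  assumes [measurable]: "f \<in> borel_measurable borel"
  shows "median (\<lambda>u. f u + k) = median f + k"
proof (rule median_eqI)
  fix a
  have "median f + k \<le> a \<longleftrightarrow> median f \<le> a - k" by auto
  also have "\<dots> \<longleftrightarrow> 1 / 2 \<le> measure gauss {u. f u + k \<le> a}"
    by (subst median_le_iff) (simp_all add: le_diff_eq)
  finally show "median f + k \<le> a \<longleftrightarrow> 1 / 2 \<le> measure gauss {u. f u + k \<le> a}" .
qed simp

lemma median_const: "median (\<lambda>u. k) = k"
proof (rule median_eqI)
  interpret gauss: prob_space gauss by (rule prob_space_gauss)
  show "k \<le> a \<longleftrightarrow> 1 / 2 \<le> measure gauss {u. k \<le> a}" for a
    using gauss.prob_space by simp
qed simp

text \<open>By \<open>median_le_iff\<close>, a sublevel set of the median is a condition on the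
  measure of a section, which is measurable in the parameter.\<close>

lemma borel_measurable_median [measurable (raw)]:
  assumes [measurable]: "(\<lambda>(x, u). f x u) \<in> borel_measurable (N \<Otimes>\<^sub>M borel)"
  shows "(\<lambda>x. median (f x)) \<in> borel_measurable N"
proof (rule borel_measurable_iff_le[THEN iffD2], rule allI)
  interpret gauss: prob_space gauss by (rule prob_space_gauss)
  fix a
  have "{x \<in> space N. median (f x) \<le> a} =
      {x \<in> space N. 1 / 2 \<le> measure gauss {u \<in> space gauss. f x u \<le> a}}"
    by (auto simp: median_le_iff)
  also have "\<dots> \<in> sets N"
    by measurable
  finally show "{x \<in> space N. median (f x) \<le> a} \<in> sets N" .
qed

section \<open>Almost-everywhere equality modulo constants\<close>

definition eq_mod_const :: "(real \<Rightarrow> real) \<Rightarrow> (real \<Rightarrow> real) \<Rightarrow> bool" where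
  "eq_mod_const p q \<longleftrightarrow> (\<exists>k. AE u in lborel. p u = q u + k)"

lemma eq_mod_const_sym: assumes "eq_mod_const p q" shows "eq_mod_const q p"
proof -
  from assms obtain k where "AE u in lborel. p u = q u + k"
    by (auto simp: eq_mod_const_def)
  then have "AE u in lborel. q u = p u + (- k)" by eventually_elim simp
  then show ?thesis unfolding eq_mod_const_def by blast
qed

lemma eq_mod_const_trans [trans]:
  assumes "eq_mod_const p q" "eq_mod_const q r" shows "eq_mod_const p r"
proof -
  from assms obtain k l where "AE u in lborel. p u = q u + k" "AE u in lborel. q u = r u + l"
    by (auto simp: eq_mod_const_def)
  then have "AE u in lborel. p u = r u + (l + k)" by eventually_elim simp
  then show ?thesis unfolding eq_mod_const_def by blast
qed

lemma median_diff_AE: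
  assumes [measurable]: "p \<in> borel_measurable borel" "q \<in> borel_measurable borel"
    and "AE u in lborel. p u = q u + k"
  shows "median (\<lambda>u. p u - q u) = k"
proof -
  have "AE u in lborel. p u - q u = k"
    using assms(3) by eventually_elim simp
  then show ?thesis
    using median_cong_AE[of "\<lambda>u. p u - q u" "\<lambda>u. k"] by (simp add: median_const)
qed

text \<open>The constant, if there is one, must be the median of the difference. This removes the
  existential quantifier, so that measurability in a parameter reduces to that of an a.e.
  condition.\<close>

lemma eq_mod_const_iff:
  assumes "p \<in> borel_measurable borel" "q \<in> borel_measurable borel"
  shows "eq_mod_const p q \<longleftrightarrow> (AE u in lborel. p u = q u + median (\<lambda>u. p u - q u))"
  using median_diff_AE[OF assms] unfolding eq_mod_const_def by blast

lemma pred_eq_mod_const: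
  assumes [measurable]: "(\<lambda>(x, u). p x u) \<in> borel_measurable (N \<Otimes>\<^sub>M borel)"
    "(\<lambda>(x, u). q x u) \<in> borel_measurable (N \<Otimes>\<^sub>M borel)"
  shows "Measurable.pred N (\<lambda>x. eq_mod_const (p x) (q x))"
proof -
  have "Measurable.pred N (\<lambda>x. AE u in lborel. p x u = q x u + median (\<lambda>u. p x u - q x u))"
    by (rule pred_AE_lborel) measurable
  also have "?this \<longleftrightarrow> ?thesis"
    by (intro measurable_cong) (simp add: eq_mod_const_iff)
  finally show ?thesis .
qed

section \<open>Null sets of times: exchange, constants, translation\<close>

lemma AE_lborel_swap:
  assumes "sigma_finite_measure N"
    and Q: "Measurable.pred (borel \<Otimes>\<^sub>M N) (\<lambda>(t, x). Q (t::real) x)"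
    and ae: "AE t in lborel. AE x in N. Q t x"
  shows "AE x in N. AE t in lborel. Q t x"
proof -
  interpret N: sigma_finite_measure N by fact
  interpret pair_sigma_finite "lborel :: real measure" N
    by (intro pair_sigma_finite.intro sigma_finite_lborel assms)
  have "Measurable.pred (lborel \<Otimes>\<^sub>M N) (\<lambda>p. Q (fst p) (snd p))"
    using Q by (simp add: split_beta' cong: measurable_cong_sets sets_pair_measure_cong)
  then show ?thesis
    using AE_commute[of Q] ae by (simp add: pred_def)
qed

text \<open>Lebesgue measure is nonzero. This serves to discard an auxiliary variable once it no
  longer occurs in the conclusion.\<close>

lemma AE_lborel_const_iff: "(AE u in lborel :: real measure. Q) \<longleftrightarrow> Q"
  unfolding AE_gauss_iff[symmetric] by (rule prob_space.AE_const[OF prob_space_gauss])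

lemma AE_lborel_const_unique:
  assumes "AE u in lborel :: real measure. f u = k" "AE u in lborel. f u = l"
  shows "k = l"
proof -
  from assms have "AE u in lborel :: real measure. k = l" by eventually_elim simp
  then show "k = l" by (simp add: AE_lborel_const_iff)
qed

lemma AE_translate:
  assumes "Measurable.pred borel Q" "AE t in lborel. Q t"
  shows "AE t in lborel. Q (s + t :: real)"
  using AE_borel_affine[of 1 Q s] assms by simp

section \<open>Flows in additive time and their affine pullbacks\<close>

text \<open>With \<open>c = exp t\<close>, this is the multiplicative flow with additive parameter; \<open>w\<close> stands for
  \<open>c\<^sup>\<kappa> b\<^sub>c (d(\<mu> \<circ> \<psi>\<^sub>c)/d\<mu>)\<^bsup>1/\<alpha>\<^esup>\<close>, where \<open>\<kappa> = H - 1/\<alpha>\<close>, and \<open>h\<close> for \<open>g\<^sub>c\<close>.\<close>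

locale twisted_flow = sigma_finite_measure M
  for M :: "'a measure" +
  fixes \<phi> :: "real \<Rightarrow> 'a \<Rightarrow> 'a" and w h :: "real \<Rightarrow> 'a \<Rightarrow> real"
  assumes measurable_flow [measurable]: "(\<lambda>(t, x). \<phi> t x) \<in> borel \<Otimes>\<^sub>M M \<rightarrow>\<^sub>M M"
    and measurable_weight [measurable]: "(\<lambda>(t, x). w t x) \<in> borel_measurable (borel \<Otimes>\<^sub>M M)"
    and measurable_shift [measurable]: "(\<lambda>(t, x). h t x) \<in> borel_measurable (borel \<Otimes>\<^sub>M M)"
    and flow_add: "x \<in> space M \<Longrightarrow> \<phi> (s + t) x = \<phi> t (\<phi> s x)"
    and weight_add: "x \<in> space M \<Longrightarrow> w (s + t) x = w s x * w t (\<phi> s x)"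
    and shift_add: "x \<in> space M \<Longrightarrow> h (s + t) x = exp (- t) * h s x + h t (\<phi> s x)"
    and nonsingular: "N \<in> null_sets M \<Longrightarrow> \<phi> t -` N \<inter> space M \<in> null_sets M"
begin

definition twist :: "real \<Rightarrow> 'a \<Rightarrow> (real \<Rightarrow> real) \<Rightarrow> real \<Rightarrow> real" where
  "twist t x q u = w t x * q (exp (- t) * u + h t x)"

lemma flow_in_space [simp]: "x \<in> space M \<Longrightarrow> \<phi> t x \<in> space M"
  using measurable_space[OF measurable_flow, of "(t, x)"] by (simp add: space_pair_measure)

text \<open>The law for \<open>h\<close> is the composition rule of the affine maps in
  \<open>u\<close>, and the weights multiply. It holds at every point of the space, which allows
  arguments along a single orbit.\<close>

lemma twist_add:
  assumes "x \<in> space M"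
  shows "twist (s + t) x q = twist s x (twist t (\<phi> s x) q)"
proof
  have "exp (- (s + t)) * u + h (s + t) x = exp (- t) * (exp (- s) * u + h s x) + h t (\<phi> s x)"
    for u
    by (simp add: shift_add assms distrib_left mult_exp_exp mult.assoc[symmetric] add.commute)
  then show "twist (s + t) x q u = twist s x (twist t (\<phi> s x) q) u" for u
    by (simp add: twist_def weight_add assms)
qed

lemma measurable_twist [measurable]:
  assumes [measurable]: "q \<in> borel_measurable borel"
  shows "twist t x q \<in> borel_measurable borel"
  unfolding twist_def[abs_def] by measurable

lemma twist_AE_shift:
  assumes [measurable]: "p \<in> borel_measurable borel" "q \<in> borel_measurable borel"
    and "AE u in lborel. p u = q u + k"
  shows "AE u in lborel. twist t x p u = twist t x q u + w t x * k"
proof -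
  have "AE u in lborel. p (h t x + exp (- t) * u) = q (h t x + exp (- t) * u) + k"
    by (rule AE_borel_affine) (use assms in auto)
  then show ?thesis
    by eventually_elim (simp add: twist_def add.commute distrib_left)
qed

lemma eq_mod_const_twist:
  assumes "p \<in> borel_measurable borel" "q \<in> borel_measurable borel" "eq_mod_const p q"
  shows "eq_mod_const (twist t x p) (twist t x q)"
  using assms twist_AE_shift[OF assms(1,2)] unfolding eq_mod_const_def by blast

lemma AE_flow: "AE x in M. Q x \<Longrightarrow> AE x in M. Q (\<phi> t x)"
proof -
  assume "AE x in M. Q x"
  then obtain N where N: "N \<in> null_sets M" "{x \<in> space M. \<not> Q x} \<subseteq> N"
    by (auto simp: eventually_ae_filter)
  show "AE x in M. Q (\<phi> t x)"
    by (rule AE_I'[OF nonsingular[OF N(1), of t]]) (use N(2) flow_in_space in blast)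
qed

end

section \<open>Repairing an almost invariant kernel\<close>

locale almost_twisted_invariant = twisted_flow M \<phi> w h
  for M :: "'a measure" and \<phi> :: "real \<Rightarrow> 'a \<Rightarrow> 'a" and w h :: "real \<Rightarrow> 'a \<Rightarrow> real" +
  fixes G :: "'a \<Rightarrow> real \<Rightarrow> real"
  assumes measurable_kernel [measurable]: "(\<lambda>(x, u). G x u) \<in> borel_measurable (M \<Otimes>\<^sub>M borel)"
    and almost_invariant: "AE x in M. eq_mod_const (G x) (twist t x (G (\<phi> t x)))"
begin

lemma measurable_section [measurable]: "x \<in> space M \<Longrightarrow> G x \<in> borel_measurable borel"
  using measurable_compose_Pair1[OF _ measurable_kernel] by simp

abbreviation pullback :: "'a \<Rightarrow> real \<Rightarrow> real \<Rightarrow> real" where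
  "pullback x t \<equiv> twist t x (G (\<phi> t x))"

definition regular :: "'a \<Rightarrow> bool" where
  "regular x \<longleftrightarrow> (AE t in lborel. eq_mod_const (G x) (pullback x t))"

text \<open>Unlike \<^const>\<open>regular\<close>, the following property is invariant under the flow.\<close>

definition orbit_regular :: "'a \<Rightarrow> bool" where
  "orbit_regular x \<longleftrightarrow> (AE t in lborel. regular (\<phi> t x))"

text \<open>The median runs over the time \<open>t\<close> with \<open>u\<close> fixed. Regular
  points keep their section, so the repair changes \<open>G\<close> only over a null set of
  \<open>x\<close>.\<close>

definition repaired :: "'a \<Rightarrow> real \<Rightarrow> real" where
  "repaired x u = (if regular x then G x u else median (\<lambda>t. pullback x t u))"

text \<open>The median reads off the constant measurably. The value 0 is compatible with additivity
  because each orbit lies entirely inside or outside the set of orbit-regular points.\<close>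

definition defect :: "real \<Rightarrow> 'a \<Rightarrow> real" where
  "defect t x =
    (if orbit_regular x then median (\<lambda>u. repaired x u - twist t x (repaired (\<phi> t x)) u) else 0)"

lemma measurable_eq_mod_const:
  "Measurable.pred (M \<Otimes>\<^sub>M borel) (\<lambda>(x, t). eq_mod_const (G x) (pullback x t))"
  unfolding split_beta' twist_def by (rule pred_eq_mod_const) measurable

lemma pred_regular [measurable]: "Measurable.pred M regular"
  unfolding regular_def by (rule pred_AE_lborel[OF measurable_eq_mod_const])

lemma pred_orbit_regular [measurable]: "Measurable.pred M orbit_regular"
  unfolding orbit_regular_def by (rule pred_AE_lborel) measurable

lemma measurable_repaired [measurable]:
  "(\<lambda>(x, u). repaired x u) \<in> borel_measurable (M \<Otimes>\<^sub>M borel)"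
  unfolding repaired_def twist_def by measurable

lemma measurable_repaired_section [measurable]:
  "x \<in> space M \<Longrightarrow> repaired x \<in> borel_measurable borel"
  using measurable_compose_Pair1[OF _ measurable_repaired] by simp

lemma measurable_defect: "(\<lambda>(t, x). defect t x) \<in> borel_measurable (borel \<Otimes>\<^sub>M M)"
  unfolding defect_def twist_def by measurable

lemma AE_regular: "AE x in M. regular x"
  unfolding regular_def
proof (rule AE_lborel_swap[OF sigma_finite_measure_axioms])
  show "Measurable.pred (borel \<Otimes>\<^sub>M M) (\<lambda>(t, x). eq_mod_const (G x) (pullback x t))"
    unfolding split_beta' twist_def by (rule pred_eq_mod_const) measurable
qed (simp add: almost_invariant)

text \<open>At each fixed time, nonsingularity carries regularity of a.e. point to a.e. image point;
  Fubini then exchanges point and time.\<close>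

lemma AE_orbit_regular: "AE x in M. orbit_regular x"
  unfolding orbit_regular_def
  by (rule AE_lborel_swap[OF sigma_finite_measure_axioms]) (measurable, simp add: AE_flow AE_regular)

text \<open>The orbit of \<open>\<phi> s x\<close> is that of \<open>x\<close> with time shifted by
  \<open>s\<close>, and null sets of times are translation invariant.\<close>

lemma orbit_regular_flow:
  assumes x: "x \<in> space M"
  shows "orbit_regular (\<phi> s x) \<longleftrightarrow> orbit_regular x"
proof
  have [measurable]: "Measurable.pred borel (\<lambda>t. regular (\<phi> t y))" if "y \<in> space M" for y
    using that by measurable
  show "orbit_regular (\<phi> s x)" if "orbit_regular x"
    using AE_translate[of "\<lambda>t. regular (\<phi> t x)" s] that x
    by (simp add: orbit_regular_def flow_add)
  show "orbit_regular x" if "orbit_regular (\<phi> s x)"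
    using AE_translate[of "\<lambda>t. regular (\<phi> t (\<phi> s x))" "- s"] that x
    by (simp add: orbit_regular_def flow_add[symmetric])
qed

lemma measurable_pullback [measurable]:
  "x \<in> space M \<Longrightarrow> pullback x t \<in> borel_measurable borel"
  by (intro measurable_twist measurable_section flow_in_space)

lemma measurable_pullback_pair:
  assumes x [measurable]: "x \<in> space M"
  shows "(\<lambda>(t, u). pullback x t u) \<in> borel_measurable (borel \<Otimes>\<^sub>M borel)"
  unfolding twist_def by measurable

lemma pullback_add:
  "x \<in> space M \<Longrightarrow> pullback x (s + t) = twist s x (pullback (\<phi> s x) t)"
  by (simp add: twist_add flow_add)

lemma AE_eq_mod_const_translate:
  assumes x: "x \<in> space M" and p: "p \<in> borel_measurable borel"
    and "AE t in lborel. eq_mod_const p (pullback x (s + t))"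
  shows "AE t in lborel. eq_mod_const p (pullback x t)"
proof -
  note [measurable] = measurable_pullback_pair[OF x] p
  have [measurable]: "Measurable.pred borel (\<lambda>t. eq_mod_const p (pullback x (s + t)))"
    by (rule pred_eq_mod_const) measurable
  from AE_translate[OF this assms(3), of "- s"] show ?thesis by simp
qed

text \<open>Regularity compares the section at \<open>\<phi> s x\<close> with its pullbacks to that
  point. Applying \<open>twist s x\<close> moves the comparison to \<open>x\<close>, with times
  shifted by \<open>s\<close>.\<close>

lemma pullbacks_eq_mod_const:
  assumes x: "x \<in> space M" and reg: "regular (\<phi> s x)"
  shows "AE t in lborel. eq_mod_const (pullback x s) (pullback x t)"
proof (rule AE_eq_mod_const_translate[OF x, where s = s])
  have "AE t in lborel. eq_mod_const (G (\<phi> s x)) (pullback (\<phi> s x) t)"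
    using reg by (simp add: regular_def)
  then show "AE t in lborel. eq_mod_const (pullback x s) (pullback x (s + t))"
    by eventually_elim (simp add: pullback_add x eq_mod_const_twist)
qed (use x in measurable)

lemma repaired_eq_mod_const_pullback:
  assumes x: "x \<in> space M" and orb: "orbit_regular x"
  shows "AE t in lborel. eq_mod_const (repaired x) (pullback x t)"
proof (cases "regular x")
  case True
  then have "repaired x = G x" by (simp add: repaired_def fun_eq_iff)
  with True show ?thesis by (simp add: regular_def)
next
  case False
  note [measurable] = measurable_pullback_pair[OF x]
  \<comment> \<open>Along an orbit the pullbacks differ by constants \<open>k t\<close>, so taking the median over \<open>t\<close> shifts
    any one of them by the median of \<open>k\<close>.\<close>
  have *: "eq_mod_const (repaired x) (pullback x s)" if reg: "regular (\<phi> s x)" for s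
  proof -
    \<comment> \<open>Choosing the constants as medians in \<open>u\<close> makes \<open>k\<close>
      measurable in \<open>t\<close>, as the exchange of quantifiers and the median over time
      require.\<close>
    define k where "k t = median (\<lambda>u. pullback x t u - pullback x s u)" for t
    note [measurable] = measurable_pullback[OF x, of s]
    have [measurable]: "k \<in> borel_measurable borel"
      unfolding k_def by measurable
    have "AE t in lborel. AE u in lborel. pullback x t u = pullback x s u + k t"
      using pullbacks_eq_mod_const[OF x reg]
    proof eventually_elim
      case (elim t)
      from eq_mod_const_sym[OF elim] show ?case
        unfolding k_def
        by (rule eq_mod_const_iff[OF measurable_pullback measurable_pullback, OF x x, THEN iffD1])
    qed
    \<comment> \<open>The quantifiers are exchanged because \<open>repaired\<close> takes its median
      over \<open>t\<close> for each fixed \<open>u\<close>.\<close>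
    then have "AE u in lborel. AE t in lborel. pullback x t u = pullback x s u + k t"
      by (rule AE_lborel_swap[OF sigma_finite_lborel, rotated]) measurable
    then have "AE u in lborel. repaired x u = pullback x s u + median k"
    proof eventually_elim
      case (elim u)
      have "repaired x u = median (\<lambda>t. pullback x t u)"
        using False by (simp add: repaired_def)
      also have "\<dots> = median (\<lambda>t. k t + pullback x s u)"
        by (rule median_cong_AE) (measurable, use elim in eventually_elim, simp)
      also have "\<dots> = median k + pullback x s u"
        by (rule median_shift) measurable
      finally show ?case by simp
    qed
    then show ?thesis unfolding eq_mod_const_def by blast
  qed
  show ?thesis
    using orb unfolding orbit_regular_def by eventually_elim (rule *)
qed

text \<open>For a.e. \<open>t\<close>, both sides agree modulo constants with
  \<open>pullback x t\<close>; for the right side, invariance of \<open>orbit_regular\<close> and a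
  time shift by \<open>s\<close> give this. One such \<open>t\<close> suffices.\<close>

lemma repaired_invariant:
  assumes x: "x \<in> space M" and orb: "orbit_regular x"
  shows "eq_mod_const (repaired x) (twist s x (repaired (\<phi> s x)))"
proof -
  have "AE t in lborel. eq_mod_const (repaired (\<phi> s x)) (pullback (\<phi> s x) t)"
    using x orb by (intro repaired_eq_mod_const_pullback) (auto simp: orbit_regular_flow)
  then have "AE t in lborel. eq_mod_const (twist s x (repaired (\<phi> s x))) (pullback x (s + t))"
    by eventually_elim (simp add: pullback_add x eq_mod_const_twist)
  then have "AE t in lborel. eq_mod_const (twist s x (repaired (\<phi> s x))) (pullback x t)"
    by (rule AE_eq_mod_const_translate[OF x, rotated]) (use x in measurable)
  with repaired_eq_mod_const_pullback[OF x orb]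
  have "AE t in lborel :: real measure. eq_mod_const (repaired x) (twist s x (repaired (\<phi> s x)))"
    by eventually_elim (blast intro: eq_mod_const_trans eq_mod_const_sym)
  then show ?thesis by (simp add: AE_lborel_const_iff)
qed

lemma repaired_defect:
  assumes x: "x \<in> space M" and orb: "orbit_regular x"
  shows "AE u in lborel. repaired x u = twist t x (repaired (\<phi> t x)) u + defect t x"
  using repaired_invariant[OF assms, of t] x orb
  by (simp add: eq_mod_const_iff defect_def measurable_repaired_section)

text \<open>Pulling back in one step or in two gives the same function, so the accumulated constants
  agree; the second constant is scaled by \<open>w s x\<close> on its way to
  \<open>x\<close>.\<close>

lemma defect_add:
  assumes x: "x \<in> space M"
  shows "defect (s + t) x = defect s x + w s x * defect t (\<phi> s x)"
proof (cases "orbit_regular x")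
  case False
  then show ?thesis using x by (simp add: defect_def orbit_regular_flow)
next
  case True
  then have orb: "orbit_regular (\<phi> s x)" using x by (simp add: orbit_regular_flow)
  let ?R = "\<lambda>u. repaired x u - twist (s + t) x (repaired (\<phi> (s + t) x)) u"
  have "AE u in lborel. twist s x (repaired (\<phi> s x)) u =
      twist s x (twist t (\<phi> s x) (repaired (\<phi> t (\<phi> s x)))) u + w s x * defect t (\<phi> s x)"
    by (intro twist_AE_shift repaired_defect measurable_twist measurable_repaired_section
        flow_in_space x orb)
  with repaired_defect[OF x True, of s]
  have "AE u in lborel. ?R u = defect s x + w s x * defect t (\<phi> s x)"
    by eventually_elim (simp add: twist_add flow_add x)
  moreover have "AE u in lborel. ?R u = defect (s + t) x"
    using repaired_defect[OF x True, of "s + t"] by eventually_elim simp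
  ultimately show ?thesis by (rule AE_lborel_const_unique[symmetric])
qed

text \<open>For fixed \<open>t\<close>, both \<open>x\<close> and \<open>\<phi> t x\<close> are
  regular for a.e. \<open>x\<close>, so the constant of the repaired kernel is there also that of
  \<open>G\<close>.\<close>

lemma AE_defect: "AE x in M. AE u in lborel. G x u = pullback x t u + defect t x"
  using AE_regular AE_flow[OF AE_regular, of t] AE_orbit_regular AE_space
proof eventually_elim
  case (elim x)
  have "repaired x = G x" "repaired (\<phi> t x) = G (\<phi> t x)"
    using elim by (simp_all add: repaired_def fun_eq_iff)
  with repaired_defect[of x t] elim show ?case by simp
qed

end

section \<open>Passage between multiplicative and additive time\<close>

lemma measurable_exp_param:
  assumes "(\<lambda>(c, x). f c x) \<in> pos_borel \<Otimes>\<^sub>M M \<rightarrow>\<^sub>M N"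
  shows "(\<lambda>(t, x). f (exp t) x) \<in> borel \<Otimes>\<^sub>M M \<rightarrow>\<^sub>M N"
proof -
  have "(\<lambda>(t, x). (exp t, x)) \<in> borel \<Otimes>\<^sub>M M \<rightarrow>\<^sub>M pos_borel \<Otimes>\<^sub>M M"
    unfolding split_beta' by (intro measurable_Pair measurable_restrict_space2) auto
  from measurable_compose[OF this assms] show ?thesis by (simp add: split_beta')
qed

lemma measurable_ln_param:
  assumes "(\<lambda>(t, x). f t x) \<in> borel \<Otimes>\<^sub>M M \<rightarrow>\<^sub>M N"
  shows "(\<lambda>(c, x). f (ln c) x) \<in> pos_borel \<Otimes>\<^sub>M M \<rightarrow>\<^sub>M N"
proof -
  have [measurable]: "(\<lambda>c. c) \<in> pos_borel \<rightarrow>\<^sub>M borel"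
    by (intro measurable_restrict_space1) simp
  have "(\<lambda>(c, x). (ln c, x)) \<in> pos_borel \<Otimes>\<^sub>M M \<rightarrow>\<^sub>M borel \<Otimes>\<^sub>M M"
    unfolding split_beta' by measurable
  from measurable_compose[OF this assms] show ?thesis by (simp add: split_beta')
qed

section \<open>Application to the kernel of the moving average\<close>

theorem theorem3p1:
  fixes \<alpha> H :: real
    and M :: "'a measure" and G :: "'a \<times> real \<Rightarrow> real"
    and P :: "'w measure" and X :: "real \<Rightarrow> 'w \<Rightarrow> real"
    and \<psi> :: "real \<Rightarrow> 'a \<Rightarrow> 'a"
    and D b g j :: "real \<Rightarrow> 'a \<Rightarrow> real"
  assumes "0 < \<alpha>" "\<alpha> < 2" "0 < H"
    and "standard_lebesgue_space M"
    and "SaS_mixed_moving_average \<alpha> M G P X"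
    and "self_similar H P X"
    and "measurable_flow M \<psi>" "nonsingular_flow M \<psi>"
    and "flow_RN_version M \<psi> D"
    and "flow_cocycle M \<psi> {-1, 1} b"
    and "one_semi_additive M \<psi> g"
    and "flow_relation \<alpha> H M G \<psi> D b g j"
    and "full_support M G"
  shows "\<exists>jt. two_semi_additive \<alpha> H M \<psi> D b jt \<and>
              (\<forall>c>0. AE x in M. jt c x = j c x) \<and>
              flow_relation \<alpha> H M G \<psi> D b g jt"
proof -
  interpret sigma_finite_measure M
    using assms(4) by (simp add: standard_lebesgue_space_def)
  interpret pair_sigma_finite M "lborel :: real measure"
    by (intro pair_sigma_finite.intro sigma_finite_measure_axioms sigma_finite_lborel)
  \<comment> \<open>Commutativity of the parameters turns the given order of composition into the
    one used by the cocycle laws.\<close>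
  have flow: "\<psi> (c1 * c2) x = \<psi> c2 (\<psi> c1 x)" if "c1 > 0" "c2 > 0" "x \<in> space M" for c1 c2 x
    using assms(7) that by (simp add: measurable_flow_def mult.commute[of c1])
  define m where "m c x = b c x * D c x powr (1 / \<alpha>)" for c x
  define \<kappa> where "\<kappa> = H - 1 / \<alpha>"
  have flow_meas [measurable]: "(\<lambda>(t, x). \<psi> (exp t) x) \<in> borel \<Otimes>\<^sub>M M \<rightarrow>\<^sub>M M"
    using assms(7) by (intro measurable_exp_param) (simp add: measurable_flow_def)
  have b_meas [measurable]: "(\<lambda>(t, x). b (exp t) x) \<in> borel_measurable (borel \<Otimes>\<^sub>M M)"
    using assms(10) by (intro measurable_exp_param)
      (simp add: flow_cocycle_def measurable_restrict_space2_iff)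
  have D_meas [measurable]: "(\<lambda>(t, x). D (exp t) x) \<in> borel_measurable (borel \<Otimes>\<^sub>M M)"
    using assms(9) by (intro measurable_exp_param)
      (simp add: flow_RN_version_def flow_cocycle_def measurable_restrict_space2_iff)
  have g_meas [measurable]: "(\<lambda>(t, x). g (exp t) x) \<in> borel_measurable (borel \<Otimes>\<^sub>M M)"
    using assms(11) by (intro measurable_exp_param) (simp add: one_semi_additive_def)
  have m_mult: "m (c1 * c2) x = m c1 x * m c2 (\<psi> c1 x)"
    if "c1 > 0" "c2 > 0" "x \<in> space M" for c1 c2 x
    using assms(9,10) that unfolding flow_RN_version_def flow_cocycle_def m_def
    by (simp add: powr_mult)
  \<comment> \<open>Isolating \<open>G\<close> in the flow relation multiplies it by
    \<open>c powr \<kappa>\<close>, which is \<open>exp (\<kappa> * t)\<close> for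
    \<open>c = exp t\<close>; the weight absorbs this factor.\<close>
  interpret twisted_flow M "\<lambda>t. \<psi> (exp t)" "\<lambda>t x. exp (\<kappa> * t) * m (exp t) x" "\<lambda>t. g (exp t)"
  proof
    show "(\<lambda>(t, x). exp (\<kappa> * t) * m (exp t) x) \<in> borel_measurable (borel \<Otimes>\<^sub>M M)"
      unfolding m_def by measurable
    fix N t assume N: "N \<in> null_sets M"
    have "\<psi> (exp t) \<in> M \<rightarrow>\<^sub>M M"
      using measurable_compose_Pair1[OF _ flow_meas, of t] by simp
    then show "\<psi> (exp t) -` N \<inter> space M \<in> null_sets M"
      using assms(8) N unfolding nonsingular_flow_def
      by (auto simp: null_sets_def intro: measurable_sets)
  next
    fix x s t assume "x \<in> space M"
    then show "g (exp (s + t)) x = exp (- t) * g (exp s) x + g (exp t) (\<psi> (exp s) x)"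
      using assms(11) by (simp add: one_semi_additive_def exp_add exp_minus field_simps)
  qed (simp_all add: exp_add flow m_mult distrib_left)
  have G_meas [measurable]: "G \<in> borel_measurable (M \<Otimes>\<^sub>M borel)"
    using assms(5) unfolding SaS_mixed_moving_average_def mixed_moving_average_kernel_def
    by (simp cong: measurable_cong_sets sets_pair_measure_cong)
  have G_section [measurable]: "(\<lambda>u. G (x, u)) \<in> borel_measurable borel" if "x \<in> space M" for x
    using measurable_compose_Pair1[OF that G_meas] .
  have relation: "AE x in M. AE u in lborel.
      G (x, u) = twist t x (\<lambda>u. G (\<psi> (exp t) x, u)) u + exp (\<kappa> * t) * j (exp t) x" for t
  proof -
    define c where "c = exp t"
    have c: "c > 0" by (simp add: c_def)
    have powr_c: "c powr (- \<kappa>) = exp (- (\<kappa> * t))" by (simp add: c_def powr_def)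
    have "AE x in M. AE u in lborel. c powr (- \<kappa>) * G (x, c * u) =
        m c x * G (\<psi> c x, u + g c x) + j c x"
      using AE_pair[of "\<lambda>(x, u). c powr (- \<kappa>) * G (x, c * u) =
        m c x * G (\<psi> c x, u + g c x) + j c x"] assms(12) c
      unfolding flow_relation_def m_def \<kappa>_def by simp
    with AE_space show ?thesis
    proof eventually_elim
      case (elim x)
      note [measurable] = G_section[OF elim(1)]
        G_section[OF flow_in_space[OF elim(1), of t, folded c_def]]
      \<comment> \<open>This puts \<open>u / c\<close> in place of \<open>u\<close>; the summand 0
        fits the shape of the rule for affine changes of variable.\<close>
      have "AE u in lborel. c powr (- \<kappa>) * G (x, c * (0 + exp (- t) * u)) =
        m c x * G (\<psi> c x, (0 + exp (- t) * u) + g c x) + j c x"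
        by (rule AE_borel_affine[OF _ _ elim(2)]) (simp, measurable)
      then show ?case
      proof eventually_elim
        case (elim u)
        have "G (x, u) = exp (\<kappa> * t) * (c powr (- \<kappa>) * G (x, c * (0 + exp (- t) * u)))"
          unfolding powr_c by (simp add: c_def mult.assoc[symmetric] mult_exp_exp)
        also note elim
        finally show ?case by (simp add: twist_def c_def distrib_left)
      qed
    qed
  qed
  interpret almost_twisted_invariant M "\<lambda>t. \<psi> (exp t)" "\<lambda>t x. exp (\<kappa> * t) * m (exp t) x"
    "\<lambda>t. g (exp t)" "\<lambda>x u. G (x, u)"
  proof
    show "AE x in M. eq_mod_const (\<lambda>u. G (x, u)) (twist t x (\<lambda>u. G (\<psi> (exp t) x, u)))" for t
      using relation[of t] by eventually_elim (auto simp: eq_mod_const_def)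
  qed simp
  \<comment> \<open>The power of \<open>c\<close> undoes the factor
    \<open>exp (\<kappa> * t)\<close> that \<open>relation\<close> puts on \<open>j\<close>.\<close>
  define jt where "jt c x = c powr (- \<kappa>) * defect (ln c) x" for c x
  have jt_eq: "AE x in M. jt c x = j c x" if c: "c > 0" for c
    using relation[of "ln c"] AE_defect[of "ln c"]
  proof eventually_elim
    case (elim x)
    \<comment> \<open>For a.e. \<open>x\<close>, one and the same difference is a.e. constant in
      \<open>u\<close> with either value.\<close>
    have "c powr \<kappa> * j c x = defect (ln c) x"
    proof (rule AE_lborel_const_unique)
      let ?f = "\<lambda>u. G (x, u) - twist (ln c) x (\<lambda>u. G (\<psi> c x, u)) u"
      show "AE u in lborel. ?f u = c powr \<kappa> * j c x"
        using elim(1) c by (auto simp: powr_def)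
      show "AE u in lborel. ?f u = defect (ln c) x"
        using elim(2) c by auto
    qed
    then show ?case
      using c by (simp add: jt_def powr_minus field_simps)
  qed
  have "two_semi_additive \<alpha> H M \<psi> D b jt"
    unfolding two_semi_additive_def
  proof (intro conjI allI impI ballI)
    have [measurable]: "(\<lambda>(c, x). defect (ln c) x) \<in> borel_measurable (pos_borel \<Otimes>\<^sub>M M)"
      by (rule measurable_ln_param[OF measurable_defect])
    have [measurable]: "(\<lambda>c. c) \<in> pos_borel \<rightarrow>\<^sub>M borel"
      by (intro measurable_restrict_space1) simp
    show "(\<lambda>(c, x). jt c x) \<in> borel_measurable (pos_borel \<Otimes>\<^sub>M M)"
      unfolding jt_def by measurable
    fix c1 c2 x assume c: "(0 :: real) < c1" "(0 :: real) < c2" and x: "x \<in> space M"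
    \<comment> \<open>The power of \<open>c1\<close> in the weight cancels the normalisation of
      \<open>jt (c1 * c2)\<close> in the second term; in the first term the power of
      \<open>c2\<close> survives.\<close>
    have "c1 powr (- \<kappa>) * exp (\<kappa> * ln c1) = 1"
      using c by (simp add: powr_def mult_exp_exp)
    moreover have "jt (c1 * c2) x = c2 powr (- \<kappa>) * (c1 powr (- \<kappa>) * defect (ln c1) x) +
        (c1 powr (- \<kappa>) * exp (\<kappa> * ln c1)) * m c1 x * (c2 powr (- \<kappa>) * defect (ln c2) (\<psi> c1 x))"
      using c defect_add[OF x, of "ln c1" "ln c2"]
      by (simp add: jt_def ln_mult powr_mult algebra_simps)
    ultimately show "jt (c1 * c2) x = c2 powr (- (H - 1 / \<alpha>)) * jt c1 x +
        b c1 x * D c1 x powr (1 / \<alpha>) * jt c2 (\<psi> c1 x)"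
      by (simp add: jt_def m_def \<kappa>_def)
  qed
  moreover have "flow_relation \<alpha> H M G \<psi> D b g jt"
    unfolding flow_relation_def
  proof (intro allI impI)
    fix c :: real assume c: "c > 0"
    \<comment> \<open>An exceptional null set of points gives a null cylinder in the product, so
      \<open>jt c\<close> may replace \<open>j c\<close> in the flow relation.\<close>
    obtain N where N: "N \<in> null_sets M" "{x \<in> space M. jt c x \<noteq> j c x} \<subseteq> N"
      using jt_eq[OF c] by (auto simp: eventually_ae_filter)
    have "AE p in M \<Otimes>\<^sub>M lborel. jt c (fst p) = j c (fst p)"
      by (rule AE_I'[of "N \<times> UNIV"])
         (use N in \<open>auto simp: space_pair_measure intro!: times_in_null_sets1\<close>)
    then show "AE (x, u) in M \<Otimes>\<^sub>M lborel. c powr (- (H - 1 / \<alpha>)) * G (x, c * u) =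
        b c x * D c x powr (1 / \<alpha>) * G (\<psi> c x, u + g c x) + jt c x"
      using assms(12)[unfolded flow_relation_def, rule_format, OF c]
      by eventually_elim auto
  qed
  ultimately show ?thesis using jt_eq by blast
qed

end
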